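(* There is a ranked alphabet $\Sigma$ and a linear EP$\Sigma$RF-TRS $R$ over $\Sigma$ such that $R$ is not a PRF-TRS.
   Context: A ranked alphabet $\Sigma$ is a finite set of symbols with ranks; $X$ a countable set of variables, $T_\Sigma(X)$ the terms, $T_\Sigma$ the ground terms. A TRS $R$ over $\Sigma$ is a finite set of rules $l\to r$, $l,r\in T_\Sigma(X)$, with every variable of $r$ occurring in $l$; $sign(R)$ is the set of symbols in its rules; linear if no variable occurs twice in any left-hand side or right-hand side. $R^*_\Sigma(L)=\{p\mid q\Rightarrow^*_R p,\ q\in L\}$. A bottom-up tree automaton (bta) over $\Sigma$ is a finite automaton with states (treated as constants), final states, rules $\delta(a_1,\dots,a_n)\to a$ and $a\to a'$, recognizing the ground terms rewriting to a final state; recognizable = recognized by some bta. $R$ is an EP$\Sigma$RF-TRS if for any given finite $L\subseteq T_\Sigma$ one can effectively construct a bta $\mathcal{C}$ over $\Sigma$ with $L(\mathcal{C})=R^*_\Sigma(L)$. $R$ is a PRF-TRS if for every ranked alphabet $\Gamma\supseteq sign(R)$, $R$ regarded as a TRS over $\Gamma$ satisfies: $R^*_\Gamma(L)$ is recognizable for every finite $L\subseteq T_\Gamma$. *)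

theory Defs
  imports Main "HOL-Library.Nat_Bijection"
begin

section \<open>Ranked alphabets and terms\<close>

text \<open>
  A ranked alphabet is a finite set of pairs (symbol, rank) in which every symbol has a unique rank.
\<close>

definition ranked_alphabet :: "('f \<times> nat) set \<Rightarrow> bool" where
  "ranked_alphabet \<Sigma> \<longleftrightarrow> finite \<Sigma> \<and> single_valued \<Sigma>"

datatype ('f, 'v) trm = Var 'v | Fun 'f "('f, 'v) trm list"

primrec var_list :: "('f, 'v) trm \<Rightarrow> 'v list" where
  "var_list (Var x) = [x]"
| "var_list (Fun f ts) = concat (map var_list ts)"

definition vars :: "('f, 'v) trm \<Rightarrow> 'v set" where
  "vars t = set (var_list t)"

primrec symbols :: "('f, 'v) trm \<Rightarrow> ('f \<times> nat) set" where
  "symbols (Var x) = {}"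
| "symbols (Fun f ts) = insert (f, length ts) (\<Union> (set (map symbols ts)))"

inductive_set terms :: "('f \<times> nat) set \<Rightarrow> ('f, 'v) trm set" for \<Sigma> where
  Var: "Var x \<in> terms \<Sigma>"
| Fun: "(f, length ts) \<in> \<Sigma> \<Longrightarrow> \<forall>t \<in> set ts. t \<in> terms \<Sigma> \<Longrightarrow> Fun f ts \<in> terms \<Sigma>"

definition ground_terms :: "('f \<times> nat) set \<Rightarrow> ('f, 'v) trm set" where
  "ground_terms \<Sigma> = {t \<in> terms \<Sigma>. vars t = {}}"

primrec subst :: "('v \<Rightarrow> ('f, 'w) trm) \<Rightarrow> ('f, 'v) trm \<Rightarrow> ('f, 'w) trm" where
  "subst \<sigma> (Var x) = \<sigma> x"
| "subst \<sigma> (Fun f ts) = Fun f (map (subst \<sigma>) ts)"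

section \<open>Term rewrite systems\<close>

type_synonym ('f, 'v) rules = "(('f, 'v) trm \<times> ('f, 'v) trm) set"

definition trs_over :: "('f \<times> nat) set \<Rightarrow> ('f, 'v) rules \<Rightarrow> bool" where
  "trs_over \<Sigma> R \<longleftrightarrow>
     finite R \<and> (\<forall>(l, r) \<in> R. l \<in> terms \<Sigma> \<and> r \<in> terms \<Sigma> \<and> vars r \<subseteq> vars l)"

definition sign :: "('f, 'v) rules \<Rightarrow> ('f \<times> nat) set" where
  "sign R = (\<Union>(l, r) \<in> R. symbols l \<union> symbols r)"

definition linear_trs :: "('f, 'v) rules \<Rightarrow> bool" where
  "linear_trs R \<longleftrightarrow> (\<forall>(l, r) \<in> R. distinct (var_list l) \<and> distinct (var_list r))"

inductive_set rstep :: "('f, 'v) rules \<Rightarrow> ('f, 'v) trm rel" for R where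
  root: "(l, r) \<in> R \<Longrightarrow> (subst \<sigma> l, subst \<sigma> r) \<in> rstep R"
| arg: "(s, t) \<in> rstep R \<Longrightarrow> (Fun f (us @ s # vs), Fun f (us @ t # vs)) \<in> rstep R"

definition rewrite_over :: "('f \<times> nat) set \<Rightarrow> ('f, 'v) rules \<Rightarrow> ('f, 'v) trm rel" where
  "rewrite_over \<Sigma> R = rstep R \<inter> terms \<Sigma> \<times> terms \<Sigma>"

definition descendants ::
    "('f \<times> nat) set \<Rightarrow> ('f, 'v) rules \<Rightarrow> ('f, 'v) trm set \<Rightarrow> ('f, 'v) trm set" where
  "descendants \<Sigma> R L = {p. \<exists>q \<in> L. (q, p) \<in> (rewrite_over \<Sigma> R)\<^sup>*}"

section \<open>Bottom-up tree automata\<close>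

text \<open>
  The automaton rewrites terms over the disjoint union of the alphabet (left summand) and the
  states (right summand), where states are constants. A triple \<open>(f, as, a)\<close> in \<open>delta\<close>
  stands for the rule \<open>f(as) \<rightarrow> a\<close>, a pair \<open>(a, a')\<close> in \<open>eps\<close> for \<open>a \<rightarrow> a'\<close>.
\<close>

record ('f, 'q) bta =
  states :: "'q set"
  final :: "'q set"
  delta :: "('f \<times> 'q list \<times> 'q) set"
  eps :: "('q \<times> 'q) set"

definition bta_over :: "('f \<times> nat) set \<Rightarrow> ('f, 'q) bta \<Rightarrow> bool" where
  "bta_over \<Sigma> C \<longleftrightarrow>
     finite (states C) \<and> final C \<subseteq> states C \<and>
     finite (delta C) \<and>
     (\<forall>(f, as, a) \<in> delta C. (f, length as) \<in> \<Sigma> \<and> set as \<subseteq> states C \<and> a \<in> states C) \<and>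
     eps C \<subseteq> states C \<times> states C"

abbreviation state_term :: "'q \<Rightarrow> ('f + 'q, 'v) trm" where
  "state_term a \<equiv> Fun (Inr a) []"

definition bta_rules :: "('f, 'q) bta \<Rightarrow> ('f + 'q, 'v) rules" where
  "bta_rules C =
     {(Fun (Inl f) (map state_term as), state_term a) | f as a. (f, as, a) \<in> delta C} \<union>
     {(state_term a, state_term a') | a a'. (a, a') \<in> eps C}"

definition bta_language :: "('f \<times> nat) set \<Rightarrow> ('f, 'q) bta \<Rightarrow> ('f, 'v) trm set" where
  "bta_language \<Sigma> C =
     {t \<in> ground_terms \<Sigma>.
        \<exists>a \<in> final C. (map_trm Inl id t, state_term a) \<in> (rstep (bta_rules C))\<^sup>*}"

text \<open>
  Natural numbers serve as states; this is no restriction, as the state sets are finite.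
\<close>

definition recognizable :: "('f \<times> nat) set \<Rightarrow> ('f, 'v) trm set \<Rightarrow> bool" where
  "recognizable \<Sigma> L \<longleftrightarrow>
     (\<exists>C :: ('f, nat) bta. bta_over \<Sigma> C \<and> bta_language \<Sigma> C = L)"

section \<open>Partial recursive functions\<close>

datatype recf =
    Zero
  | Succ
  | Proj nat
  | Comp recf "recf list"
  | PrimRec recf recf
  | Mu recf

text \<open>\<open>computes p xs y\<close>: the partial function denoted by \<open>p\<close> is defined on \<open>xs\<close> with value \<open>y\<close>.\<close>

inductive computes :: "recf \<Rightarrow> nat list \<Rightarrow> nat \<Rightarrow> bool" where
  zero: "computes Zero xs 0"
| succ: "computes Succ [x] (Suc x)"
| proj: "i < length xs \<Longrightarrow> computes (Proj i) xs (xs ! i)"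
| comp: "list_all2 (\<lambda>g y. computes g xs y) gs ys \<Longrightarrow> computes f ys z \<Longrightarrow>
         computes (Comp f gs) xs z"
| primrec_0: "computes f xs y \<Longrightarrow> computes (PrimRec f g) (0 # xs) y"
| primrec_Suc: "computes (PrimRec f g) (n # xs) y \<Longrightarrow> computes g (n # y # xs) z \<Longrightarrow>
         computes (PrimRec f g) (Suc n # xs) z"
| mu: "computes f (n # xs) 0 \<Longrightarrow> \<forall>m < n. \<exists>y. computes f (m # xs) (Suc y) \<Longrightarrow>
         computes (Mu f) xs n"

inductive_cases computes_ZeroE: "computes Zero xs y"
inductive_cases computes_SuccE: "computes Succ xs y"
inductive_cases computes_ProjE: "computes (Proj i) xs y"
inductive_cases computes_CompE: "computes (Comp f gs) xs y"
inductive_cases computes_PrimRec_0E: "computes (PrimRec f g) (0 # xs) y"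
inductive_cases computes_PrimRec_SucE: "computes (PrimRec f g) (Suc n # xs) y"
inductive_cases computes_MuE: "computes (Mu f) xs y"

lemma computes_deterministic:
  "computes p xs y \<Longrightarrow> computes p xs z \<Longrightarrow> y = z"
proof (induction arbitrary: z rule: computes.induct)
  case (zero xs)
  then show ?case by (blast elim: computes_ZeroE)
next
  case (succ x)
  then show ?case by (blast elim: computes_SuccE)
next
  case (proj i xs)
  from proj.prems show ?case by (rule computes_ProjE) simp
next
  case (comp xs gs ys f w)
  from comp.prems obtain ys' where ys': "list_all2 (\<lambda>g y. computes g xs y) gs ys'"
    and f: "computes f ys' z"
    by (rule computes_CompE)
  note len = list_all2_lengthD[OF comp.IH(1)] list_all2_lengthD[OF ys']
  have "ys = ys'"
  proof (rule nth_equalityI)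
    show "length ys = length ys'" using len by simp
    fix i assume "i < length ys"
    then have i: "i < length gs" using len by simp
    have "computes (gs ! i) xs (ys' ! i)" by (rule list_all2_nthD[OF ys' i])
    then show "ys ! i = ys' ! i" using list_all2_nthD[OF comp.IH(1) i] by simp
  qed
  with f comp.IH(2) show ?case by blast
next
  case (primrec_0 f xs y g)
  from primrec_0.prems have "computes f xs z" by (rule computes_PrimRec_0E)
  then show ?case by (rule primrec_0.IH)
next
  case (primrec_Suc f g n xs y w)
  from primrec_Suc.prems obtain y' where "computes (PrimRec f g) (n # xs) y'"
    and "computes g (n # y' # xs) z"
    by (rule computes_PrimRec_SucE)
  with primrec_Suc.IH show ?case by blast
next
  case (mu f n xs)
  from mu.prems have 1: "computes f (z # xs) 0"
    by (rule computes_MuE)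
  from mu.prems have 2: "\<forall>m < z. \<exists>y. computes f (m # xs) (Suc y)"
    by (rule computes_MuE)
  have "\<not> n < z"
  proof
    assume "n < z"
    with 2 obtain y where "computes f (n # xs) (Suc y)" by blast
    from mu.IH(1)[OF this] show False by simp
  qed
  moreover have "\<not> z < n"
  proof
    assume "z < n"
    with mu.IH(2) obtain y where "\<And>v. computes f (z # xs) v \<Longrightarrow> Suc y = v" by blast
    from this[OF 1] show False by simp
  qed
  ultimately show ?case by simp
qed

section \<open>Codes of finite tree languages and of tree automata\<close>

text \<open>
  Symbols, variables and states are natural numbers here. All codes are injective on the
  finite objects considered; \<^const>\<open>set_encode\<close> is only meaningful on finite sets.
\<close>

primrec term_code :: "(nat, nat) trm \<Rightarrow> nat" where
  "term_code (Var x) = sum_encode (Inl x)"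
| "term_code (Fun f ts) = sum_encode (Inr (prod_encode (f, list_encode (map term_code ts))))"

definition language_code :: "(nat, nat) trm set \<Rightarrow> nat" where
  "language_code L = set_encode (term_code ` L)"

definition bta_code :: "(nat, nat) bta \<Rightarrow> nat" where
  "bta_code C = list_encode
     [set_encode (states C),
      set_encode (final C),
      set_encode ((\<lambda>(f, as, a). list_encode [f, list_encode as, a]) ` delta C),
      set_encode (prod_encode ` eps C)]"

lemma term_code_inject: "term_code s = term_code t \<Longrightarrow> s = t"
proof (induction s arbitrary: t)
  case (Var x)
  then show ?case by (cases t) (auto simp: sum_encode_eq)
next
  case (Fun f ss)
  from Fun.prems obtain ts where t: "t = Fun f ts"
    and m: "map term_code ss = map term_code ts"
    by (cases t) (auto simp: sum_encode_eq prod_encode_eq list_encode_eq)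
  have "ss = ts"
    using Fun.IH m by (metis list.inj_map_strong)
  with t show ?case by simp
qed

section \<open>Preservation of recognizability of finite tree languages\<close>

text \<open>
  Effective constructibility: one partial recursive function, depending only on \<open>\<Sigma>\<close> and \<open>R\<close>, maps
  the code of every finite set of ground terms to the code of a suitable automaton.
\<close>

definition EPSRF_TRS :: "(nat \<times> nat) set \<Rightarrow> (nat, nat) rules \<Rightarrow> bool" where
  "EPSRF_TRS \<Sigma> R \<longleftrightarrow>
     (\<exists>p. \<forall>L. finite L \<longrightarrow> L \<subseteq> ground_terms \<Sigma> \<longrightarrow>
        (\<exists>C :: (nat, nat) bta. computes p [language_code L] (bta_code C) \<and>
           bta_over \<Sigma> C \<and> bta_language \<Sigma> C = descendants \<Sigma> R L))"

definition PRF_TRS :: "('f, 'v) rules \<Rightarrow> bool" where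
  "PRF_TRS R \<longleftrightarrow>
     (\<forall>\<Gamma>. ranked_alphabet \<Gamma> \<longrightarrow> sign R \<subseteq> \<Gamma> \<longrightarrow>
        (\<forall>L. finite L \<longrightarrow> L \<subseteq> ground_terms \<Gamma> \<longrightarrow> recognizable \<Gamma> (descendants \<Gamma> R L)))"

end

(*
  Let \<Sigma> consist of a constant c and unary symbols f, g, and let R have the rules
  c \<rightarrow> f(c), c \<rightarrow> g(c), f(c) \<rightarrow> c, g(c) \<rightarrow> c and f(g(x)) \<rightarrow> f(f(g(g(x)))).
  Every ground term over \<Sigma> ends in c, so it collapses to c from the inside and then expands to any
  other ground term: the descendants of a nonempty set are all ground terms, and an automaton for
  them is found by testing whether the code of the set is 0.  A fresh constant d disables the first
  four rules, and the descendants of f(g(d)) are the terms f^n(g^n(d)) with n \<ge> 1, which are not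
  recognizable by pigeonhole on the state reached at g^n(d).
*)
theory Submission imports Defs begin

section \<open>Descendants and automata\<close>

lemma vars_Var [simp]: "vars (Var x) = {x}"
  by (simp add: vars_def)

lemma vars_Fun [simp]: "vars (Fun f ts) = (\<Union>t \<in> set ts. vars t)"
  by (simp add: vars_def)

lemma vars_subst: "vars (subst \<sigma> t) = (\<Union>x \<in> vars t. vars (\<sigma> x))"
  by (induction t) auto

lemma rstep_vars_subset:
  assumes "trs_over \<Sigma> R" "(s, t) \<in> rstep R"
  shows "vars t \<subseteq> vars s"
  using assms(2)
proof induction
  case (root l r \<sigma>)
  then have "vars r \<subseteq> vars l" using assms(1) by (auto simp: trs_over_def)
  then show ?case by (auto simp: vars_subst)
qed auto

text \<open>\<open>rewrite_over\<close> keeps every step inside \<open>terms\<close>, which admits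
  variables. Groundness survives because rules, by \<open>trs_over\<close>, introduce no variables
  on the right.\<close>

lemma descendants_subset_ground_terms:
  assumes "trs_over \<Sigma> R" "L \<subseteq> ground_terms \<Sigma>"
  shows "descendants \<Sigma> R L \<subseteq> ground_terms \<Sigma>"
proof -
  have "t \<in> ground_terms \<Sigma>" if "(s, t) \<in> (rewrite_over \<Sigma> R)\<^sup>*" "s \<in> ground_terms \<Sigma>" for s t
    using that
  proof induction
    case (step t u)
    then show ?case using rstep_vars_subset[OF assms(1), of t u]
      by (auto simp: rewrite_over_def ground_terms_def)
  qed
  then show ?thesis using assms(2) by (auto simp: descendants_def)
qed

lemma Fun_in_ground_terms_iff:
  "Fun f ts \<in> ground_terms \<Sigma> \<longleftrightarrow> (f, length ts) \<in> \<Sigma> \<and> set ts \<subseteq> ground_terms \<Sigma>"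
  by (auto simp: ground_terms_def intro: terms.Fun elim: terms.cases)

lemma ground_terms_induct [consumes 1, case_names Fun]:
  assumes "t \<in> ground_terms \<Sigma>"
    and "\<And>f ts. (f, length ts) \<in> \<Sigma> \<Longrightarrow> set ts \<subseteq> ground_terms \<Sigma> \<Longrightarrow> (\<And>t. t \<in> set ts \<Longrightarrow> P t) \<Longrightarrow> P (Fun f ts)"
  shows "P t"
  using assms(1)
proof (induction t)
  case (Var x)
  then show ?case by (simp add: ground_terms_def)
next
  case (Fun f ts)
  then show ?case by (intro assms(2)) (auto simp: Fun_in_ground_terms_iff)
qed

lemma rewrite_over_root:
  assumes "(l, r) \<in> R" "subst \<sigma> l \<in> terms \<Sigma>" "subst \<sigma> r \<in> terms \<Sigma>"
  shows "(subst \<sigma> l, subst \<sigma> r) \<in> rewrite_over \<Sigma> R"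
  using assms by (auto simp: rewrite_over_def intro: rstep.root)

lemma rstep_rtrancl_unary:
  assumes "(s, t) \<in> (rstep R)\<^sup>*"
  shows "(Fun f [s], Fun f [t]) \<in> (rstep R)\<^sup>*"
  using assms
proof induction
  case (step t u)
  then show ?case using rstep.arg[of t u R f "[]" "[]"] by (auto intro: rtrancl_into_rtrancl)
qed simp

lemma rewrite_over_rtrancl_unary:
  assumes "(s, t) \<in> (rewrite_over \<Sigma> R)\<^sup>*" "(f, 1) \<in> \<Sigma>"
  shows "(Fun f [s], Fun f [t]) \<in> (rewrite_over \<Sigma> R)\<^sup>*"
  using assms(1)
proof induction
  case (step t u)
  then have "(Fun f [t], Fun f [u]) \<in> rewrite_over \<Sigma> R"
    using rstep.arg[of t u R f "[]" "[]"] assms(2)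
    by (auto simp: rewrite_over_def intro: terms.Fun)
  with step.IH show ?case by (rule rtrancl_into_rtrancl)
qed simp

section \<open>Runs of bottom-up tree automata\<close>

lemma rstep_bta_rules_delta:
  assumes "(f, as, a) \<in> delta C"
  shows "(Fun (Inl f) (map state_term as), state_term a) \<in> rstep (bta_rules C)"
  using rstep.root[of "Fun (Inl f) (map state_term as)" "state_term a" "bta_rules C" Var] assms
  by (auto simp: bta_rules_def comp_def)

lemma rstep_bta_rules_state_term:
  assumes "bta_over \<Sigma> C" "(t, state_term a) \<in> rstep (bta_rules C)"
  shows "a \<in> states C"
  using assms(2) by cases (use assms(1) in \<open>auto simp: bta_rules_def bta_over_def\<close>)

text \<open>The \<open>Inl\<close> root rules out the empty run, and the last step of a nonempty run
  ends in the target state of an automaton rule.\<close>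

lemma bta_reached_state:
  assumes "bta_over \<Sigma> C" "(Fun (Inl f) ts, state_term a) \<in> (rstep (bta_rules C))\<^sup>*"
  shows "a \<in> states C"
  using assms(2) by (cases rule: rtranclE) (auto intro: rstep_bta_rules_state_term[OF assms(1)])

text \<open>Only a \<open>delta\<close> rule can consume the root symbol, and it needs a state as
  argument. Until then all steps take place inside the argument, so the run passes through such a
  state.\<close>

lemma bta_unary_split:
  fixes s :: "('f + 'q, 'v) trm"
  assumes "(Fun (Inl f) [s], state_term a) \<in> (rstep (bta_rules C))\<^sup>*"
  shows "\<exists>b. (s, state_term b) \<in> (rstep (bta_rules C))\<^sup>* \<and>
             (Fun (Inl f) [state_term b], state_term a :: ('f + 'q, 'v) trm) \<in> (rstep (bta_rules C))\<^sup>*"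
  using assms
proof (induction "Fun (Inl f) [s]" arbitrary: s rule: converse_rtrancl_induct)
  case (step u)
  from step.hyps(1) show ?case
  proof cases
    case (root l r \<sigma>)
    then obtain b where "s = state_term b" by (auto simp: bta_rules_def)
    with step.hyps(1,2) show ?thesis by (metis converse_rtrancl_into_rtrancl rtrancl.rtrancl_refl)
  next
    case (arg s' t us vs)
    then have "(s, t) \<in> rstep (bta_rules C)" "u = Fun (Inl f) [t]"
      by (auto simp: Cons_eq_append_conv)
    with step.hyps(3) show ?thesis by (metis converse_rtrancl_into_rtrancl)
  qed
qed

section \<open>Towers of a unary symbol and non-recognizability\<close>

abbreviation unary_pow :: "'f \<Rightarrow> nat \<Rightarrow> ('f, 'v) trm \<Rightarrow> ('f, 'v) trm" where
  "unary_pow f n \<equiv> (\<lambda>t. Fun f [t]) ^^ n"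

lemma map_trm_unary_pow: "map_trm h k (unary_pow f n t) = unary_pow (h f) n (map_trm h k t)"
  by (induction n) auto

lemma rstep_rtrancl_unary_pow:
  "(s, t) \<in> (rstep R)\<^sup>* \<Longrightarrow> (unary_pow f n s, unary_pow f n t) \<in> (rstep R)\<^sup>*"
  by (induction n) (auto intro: rstep_rtrancl_unary)

lemma bta_unary_pow_split:
  fixes s :: "('f + 'q, 'v) trm"
  assumes "(unary_pow (Inl f) n s, state_term a) \<in> (rstep (bta_rules C))\<^sup>*"
  shows "\<exists>b. (s, state_term b) \<in> (rstep (bta_rules C))\<^sup>* \<and>
             (unary_pow (Inl f) n (state_term b), state_term a :: ('f + 'q, 'v) trm) \<in> (rstep (bta_rules C))\<^sup>*"
  using assms
proof (induction n arbitrary: a)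
  case (Suc n)
  from bta_unary_split[OF Suc.prems[unfolded funpow.simps comp_apply]]
  obtain c where
    c: "(unary_pow (Inl f) n s, state_term c) \<in> (rstep (bta_rules C))\<^sup>*"
    "(Fun (Inl f) [state_term c], state_term a :: ('f + 'q, 'v) trm) \<in> (rstep (bta_rules C))\<^sup>*"
    by blast
  from Suc.IH[OF c(1)] obtain b where b: "(s, state_term b) \<in> (rstep (bta_rules C))\<^sup>*"
    "(unary_pow (Inl f) n (state_term b), state_term c :: ('f + 'q, 'v) trm)
      \<in> (rstep (bta_rules C))\<^sup>*"
    by blast
  have "(unary_pow (Inl f) (Suc n) (state_term b), state_term a :: ('f + 'q, 'v) trm)
      \<in> (rstep (bta_rules C))\<^sup>*"
    using rtrancl_trans[OF rstep_rtrancl_unary[OF b(2)] c(2)] by simp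
  with b(1) show ?case by blast
qed auto

theorem not_recognizable_unary_pow:
  fixes t :: "nat \<Rightarrow> ('f, 'v) trm"
  assumes L: "\<And>m n. unary_pow f m (t n) \<in> ground_terms \<Sigma>"
      "\<And>m n. unary_pow f m (t n) \<in> L \<longleftrightarrow> m = n \<and> n > 0"
  shows "\<not> recognizable \<Sigma> L"
proof
  assume "recognizable \<Sigma> L"
  then obtain C :: "('f, nat) bta" where C: "bta_over \<Sigma> C" "bta_language \<Sigma> C = L"
    by (auto simp: recognizable_def)
  let ?R = "(rstep (bta_rules C) :: ('f + nat, 'v) trm rel)\<^sup>*"
  let ?t = "\<lambda>n. map_trm Inl id (t n) :: ('f + nat, 'v) trm"
  \<comment> \<open>The index is shifted to \<open>Suc n\<close> because \<open>L\<close> contains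
    only towers of positive height.\<close>
  have "\<exists>b. b \<in> states C \<and> (?t (Suc n), state_term b) \<in> ?R \<and>
      (\<exists>a \<in> final C. (unary_pow (Inl f) (Suc n) (state_term b), state_term a) \<in> ?R)" for n
  proof -
    have "unary_pow f (Suc n) (t (Suc n)) \<in> bta_language \<Sigma> C"
      using C(2) L(2)[of "Suc n" "Suc n"] by simp
    then obtain a where a: "a \<in> final C"
      "(map_trm Inl id (unary_pow f (Suc n) (t (Suc n))), state_term a) \<in> ?R"
      unfolding bta_language_def by blast
    obtain b where b: "(?t (Suc n), state_term b) \<in> ?R"
      "(unary_pow (Inl f) (Suc n) (state_term b), state_term a) \<in> ?R"
      using bta_unary_pow_split[OF a(2)[unfolded map_trm_unary_pow]] by blast
    have "t (Suc n) \<in> ground_terms \<Sigma>"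
      using L(1)[of 0 "Suc n"] by simp
    then obtain h ts where "t (Suc n) = Fun h ts"
      by (cases "t (Suc n)") (auto simp: ground_terms_def)
    with b(1) have "b \<in> states C"
      using bta_reached_state[OF C(1)] by simp
    with a(1) b show ?thesis by blast
  qed
  then obtain b where b: "\<And>n. b n \<in> states C" "\<And>n. (?t (Suc n), state_term (b n)) \<in> ?R"
    "\<And>n. \<exists>a \<in> final C. (unary_pow (Inl f) (Suc n) (state_term (b n)), state_term a) \<in> ?R"
    by metis
  \<comment> \<open>Pigeonhole: two different indices share a state, so the automaton cannot tell
    \<open>t (Suc m)\<close> from \<open>t (Suc n)\<close> below the tower.\<close>
  have "finite (range b)"
    using b(1) C(1) by (auto simp: bta_over_def intro: finite_subset[of _ "states C"])
  then have "\<not> inj b"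
    using finite_imageD infinite_UNIV_nat by blast
  then obtain m n where mn: "m \<noteq> n" "b m = b n"
    by (auto simp: inj_def)
  from b(3)[of m] obtain a where a: "a \<in> final C"
    "(unary_pow (Inl f) (Suc m) (state_term (b n)), state_term a) \<in> ?R"
    using mn(2) by auto
  have "(unary_pow (Inl f) (Suc m) (?t (Suc n)), state_term a) \<in> ?R"
    by (rule rtrancl_trans[OF rstep_rtrancl_unary_pow[OF b(2)] a(2)])
  then have "unary_pow f (Suc m) (t (Suc n)) \<in> bta_language \<Sigma> C"
    using a(1) L(1) unfolding bta_language_def map_trm_unary_pow[symmetric] by blast
  then show False using C(2) L(2)[of "Suc m" "Suc n"] mn(1) by simp
qed

section \<open>Constant recursive functions\<close>

primrec const_recf :: "nat \<Rightarrow> recf" where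
  "const_recf 0 = Zero"
| "const_recf (Suc n) = Comp Succ [const_recf n]"

lemma computes_const_recf: "computes (const_recf n) xs n"
proof (induction n)
  case (Suc n)
  then show ?case by (auto intro!: computes.comp[of _ _ "[n]"] computes.succ)
qed (simp add: computes.zero)

text \<open>Case distinction by primitive recursion: the base case yields \<open>a\<close>, and the
  step function ignores both the counter and the previous value.\<close>

lemma computes_if_zero:
  "computes (PrimRec (const_recf a) (const_recf b)) [n] (if n = 0 then a else b)"
proof (induction n)
  case (Suc n)
  from computes.primrec_Suc[OF Suc computes_const_recf] show ?case by simp
qed (auto intro: computes.primrec_0 computes_const_recf)

text \<open>\<open>set_encode\<close> is a sum of powers of two, hence positive on nonempty finite
  sets. On an infinite set the sum would default to 0.\<close>

lemma language_code_eq_0_iff: "finite L \<Longrightarrow> language_code L = 0 \<longleftrightarrow> L = {}"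
  by (auto simp: language_code_def set_encode_def)

section \<open>The rewrite system\<close>

text \<open>The symbols c, f, g and the additional constant d are 0, 1, 2 and 3.\<close>

definition alph :: "(nat \<times> nat) set" where
  "alph = {(0, 0), (1, 1), (2, 1)}"

definition sys :: "(nat, nat) rules" where
  "sys = {(Fun 0 [], Fun 1 [Fun 0 []]), (Fun 0 [], Fun 2 [Fun 0 []]),
          (Fun 1 [Fun 0 []], Fun 0 []), (Fun 2 [Fun 0 []], Fun 0 []),
          (Fun 1 [Fun 2 [Var 0]], Fun 1 [Fun 1 [Fun 2 [Fun 2 [Var 0]]]])}"

lemma ranked_alphabet_alph: "ranked_alphabet alph"
  by (auto simp: ranked_alphabet_def alph_def single_valued_def)

lemma trs_over_sys: "trs_over alph sys"
  by (auto simp: trs_over_def sys_def alph_def intro!: terms.intros)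

lemma linear_trs_sys: "linear_trs sys"
  by (auto simp: linear_trs_def sys_def)

lemma alph_ground_terms_induct [consumes 1, case_names c unary]:
  assumes "t \<in> ground_terms alph"
    and "P (Fun 0 [])"
    and "\<And>f s. f \<in> {1, 2} \<Longrightarrow> s \<in> ground_terms alph \<Longrightarrow> P s \<Longrightarrow> P (Fun f [s])"
  shows "P t"
  using assms(1)
proof (induction rule: ground_terms_induct)
  case (Fun f ts)
  then consider "f = 0" "ts = []" | s where "f \<in> {1, 2}" "ts = [s]"
    by (auto simp: alph_def length_Suc_conv)
  then show ?case using Fun assms(2,3) by cases auto
qed

section \<open>Reachability over \<open>alph\<close>\<close>

lemma c_in_terms: "Fun 0 [] \<in> terms alph"
  by (auto simp: alph_def intro: terms.Fun)

lemma unary_c_in_terms: "f \<in> {1, 2} \<Longrightarrow> Fun f [Fun 0 []] \<in> terms alph"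
  using c_in_terms by (auto simp: alph_def intro!: terms.Fun)

lemma c_rewrite_unary:
  assumes "f \<in> {1, 2}"
  shows "(Fun 0 [], Fun f [Fun 0 []]) \<in> rewrite_over alph sys"
    "(Fun f [Fun 0 []], Fun 0 []) \<in> rewrite_over alph sys"
  using rewrite_over_root[of "Fun 0 []" "Fun f [Fun 0 []]" sys Var alph]
    rewrite_over_root[of "Fun f [Fun 0 []]" "Fun 0 []" sys Var alph]
    assms c_in_terms unary_c_in_terms by (auto simp: sys_def)

lemma rewrite_to_c_and_back:
  assumes "t \<in> ground_terms alph"
  shows "(t, Fun 0 []) \<in> (rewrite_over alph sys)\<^sup>* \<and> (Fun 0 [], t) \<in> (rewrite_over alph sys)\<^sup>*"
  using assms
proof (induction rule: alph_ground_terms_induct)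
  case (unary f s)
  then have "(f, 1) \<in> alph" by (auto simp: alph_def)
  \<comment> \<open>For h in {f, g} the two chains are h(s) \<rightarrow>* h(c) \<rightarrow> c and
    c \<rightarrow> h(c) \<rightarrow>* h(s).\<close>
  with unary show ?case
    using rewrite_over_rtrancl_unary[of s "Fun 0 []" alph sys f]
      rewrite_over_rtrancl_unary[of "Fun 0 []" s alph sys f] c_rewrite_unary[of f]
    by (meson converse_rtrancl_into_rtrancl rtrancl_into_rtrancl)
qed simp

lemma descendants_alph:
  assumes "L \<subseteq> ground_terms alph" "L \<noteq> {}"
  shows "descendants alph sys L = ground_terms alph"
proof
  from assms obtain s where "s \<in> L" "s \<in> ground_terms alph" by blast
  then show "ground_terms alph \<subseteq> descendants alph sys L"
    unfolding descendants_def using rewrite_to_c_and_back by (blast intro: rtrancl_trans)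
qed (rule descendants_subset_ground_terms[OF trs_over_sys assms(1)])

section \<open>Automata for the descendants over \<open>alph\<close>\<close>

definition empty_bta :: "(nat, nat) bta" where
  "empty_bta = \<lparr>states = {}, final = {}, delta = {}, eps = {}\<rparr>"

definition full_bta :: "(nat, nat) bta" where
  "full_bta = \<lparr>states = {0}, final = {0}, delta = {(0, [], 0), (1, [0], 0), (2, [0], 0)}, eps = {}\<rparr>"

lemma bta_over_empty_bta: "bta_over \<Sigma> empty_bta"
  by (simp add: bta_over_def empty_bta_def)

lemma bta_language_empty_bta: "bta_language \<Sigma> empty_bta = {}"
  by (simp add: bta_language_def empty_bta_def)

lemma bta_over_full_bta: "bta_over alph full_bta"
  by (simp add: bta_over_def full_bta_def alph_def)

lemma bta_language_full_bta: "bta_language alph full_bta = ground_terms alph"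
proof -
  have "(map_trm Inl id t, state_term 0) \<in> (rstep (bta_rules full_bta))\<^sup>*"
    if "t \<in> ground_terms alph" for t :: "(nat, 'v) trm"
    using that
  proof (induction rule: alph_ground_terms_induct)
    case c
    show ?case using rstep_bta_rules_delta[of 0 "[]" 0 full_bta] by (auto simp: full_bta_def)
  next
    case (unary f s)
    then have "(Fun (Inl f) [state_term 0], state_term 0) \<in> rstep (bta_rules full_bta)"
      using rstep_bta_rules_delta[of f "[0]" 0 full_bta] by (auto simp: full_bta_def)
    with rstep_rtrancl_unary[OF unary.IH, of "Inl f"] show ?case
      by (auto intro: rtrancl_into_rtrancl)
  qed
  then show ?thesis by (auto simp: bta_language_def full_bta_def)
qed

lemma EPSRF_TRS_sys: "EPSRF_TRS alph sys"
  unfolding EPSRF_TRS_def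
proof (intro exI allI impI)
  fix L :: "(nat, nat) trm set"
  assume L: "finite L" "L \<subseteq> ground_terms alph"
  \<comment> \<open>The function must serve all \<open>L\<close> at once: it contains only the codes
    of two fixed automata and chooses between them by its argument.\<close>
  let ?p = "PrimRec (const_recf (bta_code empty_bta)) (const_recf (bta_code full_bta))"
  let ?C = "if L = {} then empty_bta else full_bta"
  have "computes ?p [language_code L] (bta_code ?C)"
    using computes_if_zero[of "bta_code empty_bta" "bta_code full_bta" "language_code L"] L(1)
    by (cases "L = {}") (simp_all add: language_code_eq_0_iff)
  moreover have "bta_over alph ?C"
    by (simp add: bta_over_empty_bta bta_over_full_bta)
  moreover have "bta_language alph ?C = descendants alph sys L"
  proof (cases "L = {}")
    case True
    then show ?thesis by (simp add: bta_language_empty_bta descendants_def)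
  next
    case False
    with L(2) show ?thesis by (simp add: bta_language_full_bta descendants_alph)
  qed
  ultimately show "computes ?p [language_code L] (bta_code ?C) \<and>
      bta_over alph ?C \<and> bta_language alph ?C = descendants alph sys L"
    by blast
qed

section \<open>Rewriting towers that end in d\<close>

abbreviation d_term :: "nat \<Rightarrow> nat \<Rightarrow> (nat, nat) trm" where
  "d_term m n \<equiv> unary_pow 1 m (unary_pow 2 n (Fun 3 []))"

lemma rstep_unary_cases:
  assumes "(Fun f [s], t) \<in> rstep R"
  obtains (root) l r \<sigma> where "(l, r) \<in> R" "Fun f [s] = subst \<sigma> l" "t = subst \<sigma> r"
    | (arg) s' where "(s, s') \<in> rstep R" "t = Fun f [s']"
  using assms by cases (auto simp: Cons_eq_append_conv)

text \<open>The rules rooted in c or g need a c in the term, which ends in d instead; the other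
  rules need an f.\<close>

lemma rstep_sys_g_pow: "(unary_pow 2 n (Fun 3 []), t) \<notin> rstep sys"
proof (induction n arbitrary: t)
  case 0
  show ?case by (auto simp: sys_def elim: rstep.cases)
next
  case (Suc n)
  have "unary_pow 2 n (Fun 3 []) \<noteq> (Fun 0 [] :: (nat, nat) trm)" by (cases n) auto
  then show ?case using Suc by (auto simp: sys_def elim!: rstep_unary_cases)
qed

text \<open>The only possible redex is the border where the last f meets the first g, and
  contracting it adds one f and one g. If \<open>m\<close> or \<open>n\<close> is 0 there is no
  redex and the claim is vacuous.\<close>

lemma rstep_sys_d_term:
  assumes "(d_term m n, t) \<in> rstep sys"
  shows "t = d_term (Suc m) (Suc n)"
  using assms
proof (induction m arbitrary: t)
  case 0
  then show ?case using rstep_sys_g_pow by simp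
next
  case (Suc m)
  from Suc.prems have "(Fun 1 [d_term m n], t) \<in> rstep sys" by simp
  then show ?case
  proof (cases rule: rstep_unary_cases)
    case (root l r \<sigma>)
    \<comment> \<open>This excludes f(c) \<rightarrow> c at the root, leaving only the rule for
      f(g(x)).\<close>
    have "d_term m n \<noteq> Fun 0 []" by (cases m; cases n) auto
    with root obtain s where s: "d_term m n = Fun 2 [s]" "t = Fun 1 [Fun 1 [Fun 2 [Fun 2 [s]]]]"
      by (auto simp: sys_def)
    \<comment> \<open>Here \<open>m\<close> counts the f's below the root, so the root is the last
      f.\<close>
    then have "m = 0" by (cases m) auto
    with s show ?thesis by (cases n) auto
  next
    case (arg s')
    with Suc.IH show ?thesis by simp
  qed
qed

lemma rstep_sys_d_term_Suc:
  "(d_term (Suc n) (Suc n), d_term (Suc (Suc n)) (Suc (Suc n))) \<in> rstep sys"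
proof -
  let ?s = "unary_pow 2 n (Fun 3 [])"
  have root: "(Fun 1 [Fun 2 [?s]], Fun 1 [Fun 1 [Fun 2 [Fun 2 [?s]]]]) \<in> rstep sys"
    using rstep.root[of "Fun 1 [Fun 2 [Var 0]]" "Fun 1 [Fun 1 [Fun 2 [Fun 2 [Var 0]]]]" sys
        "\<lambda>_. ?s"] by (simp add: sys_def)
  have "(unary_pow 1 m (Fun 1 [Fun 2 [?s]]), unary_pow 1 m (Fun 1 [Fun 1 [Fun 2 [Fun 2 [?s]]]]))
      \<in> rstep sys" for m
  proof (induction m)
    case (Suc m)
    then show ?case using rstep.arg[of _ _ sys 1 "[]" "[]"] by simp
  qed (use root in simp)
  \<comment> \<open>\<open>unary_pow\<close> unfolds at the outermost symbol, but the redex uses the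
    innermost f, so one f is moved to the inside.\<close>
  moreover have "unary_pow 1 (Suc m) t = unary_pow 1 m (Fun 1 [t])" for m and t :: "(nat, nat) trm"
    by (induction m) auto
  moreover have "unary_pow 2 (Suc m) t = Fun 2 [unary_pow 2 m t]" for m and t :: "(nat, nat) trm"
    by simp
  ultimately show ?thesis by (simp only:)
qed

definition alph_d :: "(nat \<times> nat) set" where
  "alph_d = insert (3, 0) alph"

lemma d_term_ground: "d_term m n \<in> ground_terms alph_d"
proof (induction m)
  case 0
  show ?case by (induction n) (auto simp: Fun_in_ground_terms_iff alph_d_def alph_def)
qed (auto simp: Fun_in_ground_terms_iff alph_d_def alph_def)

text \<open>This reduces membership among the descendants to a comparison of exponents.\<close>

lemma d_term_inject: "d_term m n = d_term m' n' \<longleftrightarrow> m = m' \<and> n = n'"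
proof (induction m arbitrary: m')
  case 0
  have "unary_pow 2 n (Fun 3 []) = (unary_pow 2 n' (Fun 3 []) :: (nat, nat) trm) \<longleftrightarrow> n = n'" for n n'
  proof (induction n arbitrary: n')
    case 0
    show ?case by (cases n') auto
  next
    case (Suc n)
    then show ?case by (cases n') auto
  qed
  moreover have "unary_pow 2 n (Fun 3 []) \<noteq> (Fun 1 [t] :: (nat, nat) trm)" for t
    by (cases n) auto
  ultimately show ?case by (cases m') auto
next
  case (Suc m)
  moreover have "Fun 1 [t] \<noteq> (unary_pow 2 n' (Fun 3 []) :: (nat, nat) trm)" for t
    by (cases n') auto
  ultimately show ?case by (cases m') auto
qed

text \<open>The rewrite steps form a single infinite chain: \<open>rstep_sys_d_term\<close> says
  each step is forced, \<open>rstep_sys_d_term_Suc\<close> that it is always possible. Each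
  inclusion is an induction along this chain.\<close>

lemma descendants_d_term:
  "descendants alph_d sys {d_term 1 1} = (\<lambda>n. d_term (Suc n) (Suc n)) ` UNIV"
proof
  have "\<exists>n. t = d_term (Suc n) (Suc n)" if "(d_term 1 1, t) \<in> (rewrite_over alph_d sys)\<^sup>*" for t
    using that
  proof induction
    case base
    show ?case by (rule exI[of _ 0]) simp
  next
    case (step t u)
    then show ?case by (metis IntE rewrite_over_def rstep_sys_d_term)
  qed
  then show "descendants alph_d sys {d_term 1 1} \<subseteq> (\<lambda>n. d_term (Suc n) (Suc n)) ` UNIV"
    by (auto simp: descendants_def)
next
  have "(d_term 1 1, d_term (Suc n) (Suc n)) \<in> (rewrite_over alph_d sys)\<^sup>*" for n
  proof (induction n)
    case (Suc n)
    have "(d_term (Suc n) (Suc n), d_term (Suc (Suc n)) (Suc (Suc n))) \<in> rewrite_over alph_d sys"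
      unfolding rewrite_over_def using rstep_sys_d_term_Suc d_term_ground
      unfolding ground_terms_def by blast
    with Suc show ?case by (rule rtrancl_into_rtrancl)
  qed simp
  then show "(\<lambda>n. d_term (Suc n) (Suc n)) ` UNIV \<subseteq> descendants alph_d sys {d_term 1 1}"
    by (auto simp: descendants_def)
qed

lemma not_PRF_TRS_sys: "\<not> PRF_TRS sys"
proof
  assume "PRF_TRS sys"
  moreover have "ranked_alphabet alph_d"
    by (auto simp: ranked_alphabet_def alph_d_def alph_def single_valued_def)
  moreover have "sign sys \<subseteq> alph_d"
    by (auto simp: sign_def sys_def alph_d_def alph_def)
  ultimately have "recognizable alph_d (descendants alph_d sys {d_term 1 1})"
    using d_term_ground[of 1 1] unfolding PRF_TRS_def by blast
  moreover have "d_term m n \<in> descendants alph_d sys {d_term 1 1} \<longleftrightarrow> m = n \<and> n > 0" for m n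
    unfolding descendants_d_term image_iff bex_UNIV d_term_inject
    using gr0_conv_Suc by auto
  ultimately show False
    \<comment> \<open>The criterion is applied with f as the tower symbol and g^n(d) as the term
      below the tower.\<close>
    using not_recognizable_unary_pow[of 1 "\<lambda>n. unary_pow 2 n (Fun 3 [])", OF d_term_ground]
    by blast
qed

theorem mainTheorem15:
  "\<exists>(\<Sigma> :: (nat \<times> nat) set) (R :: (nat, nat) rules).
     ranked_alphabet \<Sigma> \<and> trs_over \<Sigma> R \<and> linear_trs R \<and> EPSRF_TRS \<Sigma> R \<and> \<not> PRF_TRS R"
  using ranked_alphabet_alph trs_over_sys linear_trs_sys EPSRF_TRS_sys not_PRF_TRS_sys by blast

end
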